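(* Let $H[u]=\int_\Omega h(u)\,dx$ with Fréchet derivative $DH[u]$ (identified with $h'(u)$), let $A[u]=K[u]DH[u]$, where for each $u\in D(A)$ the operator $K[u]$ is linear and symmetric, and let $u^k$ be a solution to a Runge-Kutta scheme of order $p\ge2$, $$u^{k}=u^{k-1}+\tau\sum_{i=1}^s b_iK_i,\qquad K_i=-A\Big[u^{k-1}+\tau\sum_{j=1}^s a_{ij}K_j\Big],\quad i=1,\dots,s .$$ Let $G(\tau)=H[u^k]-H[v(\tau)]$, where $v(\tau)=u^{k-1}$ is the backward solution of the scheme with step size $\tau$ for the fixed function $u^k$, and let $$M(u,\xi):=\langle\xi,DA[u]K[u]\xi\rangle-\tfrac12\langle\xi,DK[u](A[u])\,\xi\rangle .$$ Then $$G''(0)=-2M(u^k,DH[u^k]) .$$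
   Context: Setting: $A$ is a Fréchet differentiable (differential) operator defined on $D(A)\subset X$, $X$ a Banach space of functions on $\Omega$; $\partial_t u=-A[u]=-K[u]DH[u]$ is the underlying gradient-flow equation. $\langle\cdot,\cdot\rangle$ is the ($L^2$-type) duality pairing, $DA[u](w)$ is the Fréchet derivative of $A$ at $u$ in direction $w$, and $DK[u](w)\xi$ is the derivative of $u\mapsto K[u]\xi$ at $u$ in direction $w$ (for fixed $\xi$). The operators $K[u]$ should not be confused with the Runge-Kutta stages $K_i$. Runge-Kutta scheme: $s\ge1$ stages, real coefficients $a_{ij},b_i$, $c_i:=\sum_{j=1}^s a_{ij}$, consistency $\sum_{i=1}^s b_i=1$; order $p\ge2$ means in particular $\sum_{i=1}^s b_ic_i=\frac12$, so that $C_{\rm RK}:=2\sum_{i=1}^s b_i(1-c_i)=1$. Backward solution: $u^k$ is fixed; there are $\tau_0>0$ and twice continuously differentiable maps $\tau\mapsto v(\tau)$, $\tau\mapsto K_i(\tau)$ on $[0,\tau_0)$ such that for each $\tau$ the scheme holds with this $u^k$, with $u^{k-1}=v(\tau)$ and stages $K_i(\tau)$ (so $v(0)=u^k$). All functions and operators are assumed sufficiently regular that $\tau\mapsto A[v(\tau)+\tau\sum_j a_{ij}K_j(\tau)]$ can be differentiated by the chain rule, that $G$ is $C^2$ with derivatives obtained by the chain rule under the integral, and that the chain and product rules apply to $A[u]=K[u]h'(u)$. *)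

theory Defs
  imports "HOL-Analysis.Analysis"
begin

text \<open>
  A Banach space of functions on \<open>\<Omega>\<close> is a normed type together with a realisation map \<open>r\<close>
  sending each element to a representative modulo null sets.
\<close>

definition function_space ::
  "'a::euclidean_space set \<Rightarrow> ('x::real_normed_vector \<Rightarrow> 'a \<Rightarrow> real) \<Rightarrow> bool" where
  "function_space \<Omega> r \<longleftrightarrow>
     (\<forall>u. r u \<in> borel_measurable (lebesgue_on \<Omega>)) \<and>
     (\<forall>u w. AE x in lebesgue_on \<Omega>. r (u + w) x = r u x + r w x) \<and>
     (\<forall>c u. AE x in lebesgue_on \<Omega>. r (c *\<^sub>R u) x = c * r u x) \<and>
     (\<forall>u. (AE x in lebesgue_on \<Omega>. r u x = 0) \<longrightarrow> u = 0)"

text \<open>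
  The embedding does not change the underlying function; only the norm changes.
  It allows a differential operator to be Frechet differentiable from a space \<open>X\<close> into a
  space with a weaker norm; \<open>emb = id\<close> is the case of a single space.
\<close>

definition continuous_embedding ::
  "'a::euclidean_space set \<Rightarrow> ('x::real_normed_vector \<Rightarrow> 'a \<Rightarrow> real) \<Rightarrow>
   ('z::real_normed_vector \<Rightarrow> 'a \<Rightarrow> real) \<Rightarrow> ('x \<Rightarrow> 'z) \<Rightarrow> bool" where
  "continuous_embedding \<Omega> rX rZ emb \<longleftrightarrow>
     bounded_linear emb \<and> (\<forall>u. AE x in lebesgue_on \<Omega>. rZ (emb u) x = rX u x)"

lemma continuous_embedding_inj:
  assumes "function_space \<Omega> rX" "continuous_embedding \<Omega> rX rZ emb" "function_space \<Omega> rZ"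
  shows "inj emb"
proof -
  interpret bounded_linear emb using assms(2) by (simp add: continuous_embedding_def)
  show ?thesis
  proof (rule linear_injective_0[THEN iffD2, OF linear_axioms], intro allI impI)
    fix u assume u: "emb u = 0"
    have "AE x in lebesgue_on \<Omega>. rZ (0 *\<^sub>R emb u) x = 0 * rZ (emb u) x"
      using assms(3) unfolding function_space_def by blast
    moreover have "AE x in lebesgue_on \<Omega>. rZ (emb u) x = rX u x"
      using assms(2) unfolding continuous_embedding_def by blast
    ultimately have "AE x in lebesgue_on \<Omega>. rX u x = 0" by eventually_elim (simp add: u)
    then show "u = 0" using assms(1) unfolding function_space_def by blast
  qed
qed

definition pairing ::
  "'a::euclidean_space set \<Rightarrow> ('e \<Rightarrow> 'a \<Rightarrow> real) \<Rightarrow> ('z \<Rightarrow> 'a \<Rightarrow> real) \<Rightarrow> 'e \<Rightarrow> 'z \<Rightarrow> real" where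
  "pairing \<Omega> rE rZ \<xi> w = (\<integral>x. rE \<xi> x * rZ w x \<partial>lebesgue_on \<Omega>)"

definition in_duality ::
  "'a::euclidean_space set \<Rightarrow> ('e::real_normed_vector \<Rightarrow> 'a \<Rightarrow> real) \<Rightarrow>
   ('z::real_normed_vector \<Rightarrow> 'a \<Rightarrow> real) \<Rightarrow> bool" where
  "in_duality \<Omega> rE rZ \<longleftrightarrow>
     (\<forall>\<xi> w. integrable (lebesgue_on \<Omega>) (\<lambda>x. rE \<xi> x * rZ w x)) \<and>
     (\<exists>C. \<forall>\<xi> w. \<bar>pairing \<Omega> rE rZ \<xi> w\<bar> \<le> C * norm \<xi> * norm w)"

definition entropy ::
  "'a::euclidean_space set \<Rightarrow> ('x \<Rightarrow> 'a \<Rightarrow> real) \<Rightarrow> (real \<Rightarrow> real) \<Rightarrow> 'x \<Rightarrow> real" where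
  "entropy \<Omega> rX h u = (\<integral>x. h (rX u x) \<partial>lebesgue_on \<Omega>)"

definition C2_on :: "(real \<Rightarrow> 'b::real_normed_vector) \<Rightarrow> real set \<Rightarrow> bool" where
  "C2_on f S \<longleftrightarrow> (\<exists>f' f''.
     (\<forall>t\<in>S. (f has_vector_derivative f' t) (at t within S)) \<and>
     (\<forall>t\<in>S. (f' has_vector_derivative f'' t) (at t within S)) \<and>
     continuous_on S f'')"

text \<open>
  A Runge-Kutta method has order (at least) \<open>p\<close> if Butcher's order condition holds for every
  rooted tree with at most \<open>p\<close> vertices. Trees are ordered here, which only repeats conditions.
\<close>

datatype rtree = Node "rtree list"

fun rtree_size :: "rtree \<Rightarrow> nat" where
  "rtree_size (Node ts) = 1 + (\<Sum>t\<leftarrow>ts. rtree_size t)"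

fun rtree_density :: "rtree \<Rightarrow> nat" where
  "rtree_density (Node ts) = rtree_size (Node ts) * (\<Prod>t\<leftarrow>ts. rtree_density t)"

fun stage_weight :: "nat \<Rightarrow> (nat \<Rightarrow> nat \<Rightarrow> real) \<Rightarrow> rtree \<Rightarrow> nat \<Rightarrow> real" where
  "stage_weight s a (Node ts) i = (\<Prod>t\<leftarrow>ts. \<Sum>j=1..s. a i j * stage_weight s a t j)"

definition rk_order :: "nat \<Rightarrow> (nat \<Rightarrow> nat \<Rightarrow> real) \<Rightarrow> (nat \<Rightarrow> real) \<Rightarrow> nat \<Rightarrow> bool" where
  "rk_order s a b p \<longleftrightarrow>
     (\<forall>t. rtree_size t \<le> p \<longrightarrow>
        (\<Sum>i=1..s. b i * stage_weight s a t i) = 1 / real (rtree_density t))"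

lemma rk_order_consistent:
  assumes "rk_order s a b p" "p \<ge> 1"
  shows "(\<Sum>i=1..s. b i) = 1"
  using assms(1)[unfolded rk_order_def, THEN spec[of _ "Node []"]] assms(2) by simp

lemma rk_order_two:
  assumes "rk_order s a b p" "p \<ge> 2"
  shows "(\<Sum>i=1..s. b i * (\<Sum>j=1..s. a i j)) = 1 / 2"
  using assms(1)[unfolded rk_order_def, THEN spec[of _ "Node [Node []]"]] assms(2) by simp

text \<open>
  One step of size \<open>\<tau>\<close> from \<open>u0\<close> to \<open>u1\<close> with stages \<open>k\<close>. The operator \<open>A\<close> is only meaningful
  on its domain \<open>D\<close>, so its arguments are required to lie there.
\<close>

definition rk_step ::
  "nat \<Rightarrow> (nat \<Rightarrow> nat \<Rightarrow> real) \<Rightarrow> (nat \<Rightarrow> real) \<Rightarrow> ('x::real_normed_vector \<Rightarrow> 'z::real_normed_vector) \<Rightarrow>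
   'x set \<Rightarrow> ('x \<Rightarrow> 'z) \<Rightarrow> real \<Rightarrow> 'x \<Rightarrow> (nat \<Rightarrow> 'x) \<Rightarrow> 'x \<Rightarrow> bool" where
  "rk_step s a b emb D A \<tau> u0 k u1 \<longleftrightarrow>
     u1 = u0 + \<tau> *\<^sub>R (\<Sum>i=1..s. b i *\<^sub>R k i) \<and>
     (\<forall>i\<in>{1..s}.
        u0 + \<tau> *\<^sub>R (\<Sum>j=1..s. a i j *\<^sub>R k j) \<in> D \<and>
        emb (k i) = - A (u0 + \<tau> *\<^sub>R (\<Sum>j=1..s. a i j *\<^sub>R k j)))"

text \<open>
  \<open>inv emb\<close> regards a function of the weaker space as an element of \<open>X\<close>. The expression is
  meaningful only if \<open>K u \<xi>\<close> and \<open>A u\<close> belong to \<open>X\<close>. For \<open>\<xi> = DH u\<close> at the end point of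
  a Runge-Kutta step with arbitrarily small step sizes both are \<open>A u\<close>, which is minus a stage at
  step size \<open>0\<close>.
\<close>

definition M_form ::
  "('e \<Rightarrow> 'z \<Rightarrow> real) \<Rightarrow> ('x \<Rightarrow> 'z) \<Rightarrow> ('x \<Rightarrow> 'z) \<Rightarrow> ('x \<Rightarrow> 'x \<Rightarrow> 'z) \<Rightarrow>
   ('x \<Rightarrow> 'e \<Rightarrow> 'z) \<Rightarrow> ('x \<Rightarrow> 'x \<Rightarrow> 'e \<Rightarrow> 'z) \<Rightarrow> 'x \<Rightarrow> 'e \<Rightarrow> real" where
  "M_form pr emb A DA K DK u \<xi> =
     pr \<xi> (DA u (inv emb (K u \<xi>))) - 1 / 2 * pr \<xi> (DK u (inv emb (A u)) \<xi>)"

end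

theory Submission
  imports Defs
begin

text \<open>
  Along the backward solution the chain rule gives
  \<open>G'(\<tau>) = - \<langle>DH[v(\<tau>)], v'(\<tau>)\<rangle>\<close>, so that \<open>G''(0)\<close> splits into the two terms
  \<open>- \<langle>DH'(v'(0)), v'(0)\<rangle>\<close> and \<open>- \<langle>DH[u\<^sup>k], v''(0)\<rangle>\<close>.

  At \<open>\<tau> = 0\<close> every stage solves \<open>k = - A[u\<^sup>k]\<close>, so all stages have a common value \<open>\<kappa>\<close>, and
  consistency gives \<open>v'(0) = - \<kappa>\<close>. Differentiating \<open>v = u\<^sup>k - \<tau> \<Sum> b\<^sub>i K\<^sub>i\<close> twice and the stage equations once gives
  \<open>v''(0) = - 2 \<Sum> b\<^sub>i K\<^sub>i'(0) = - 2 \<Sum> b\<^sub>i (1 - c\<^sub>i) DA[u\<^sup>k](\<kappa>)\<close>, and the conditions of order two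
  (\<open>rk_order_consistent\<close>, \<open>rk_order_two\<close>) turn the constant into \<open>-1\<close>
  (\<open>backward_acceleration\<close>).

  The second derivative of \<open>H\<close> in the first term has to be eliminated, since \<open>M\<close> contains only
  derivatives of \<open>A\<close> and \<open>K\<close>. As \<open>K[u]\<xi>\<close> is differentiable in \<open>u\<close> only for fixed \<open>\<xi>\<close>, and
  \<open>K[u]\<close> may be unbounded, the product \<open>K[u] DH[u]\<close> cannot be differentiated directly. Paired with
  a fixed \<open>\<xi>\<close>, however, symmetry moves the varying argument out of \<open>K\<close>:
  \<open>\<langle>\<xi>, A[u]\<rangle> = \<langle>\<xi>, K[u] DH[u]\<rangle> = \<langle>DH[u], K[u] \<xi>\<rangle>\<close>, and the right-hand side is a
  bounded bilinear expression in two differentiable functions (\<open>symmetric_product_rule\<close>).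
  For \<open>\<xi> = DH[u\<^sup>k]\<close> this gives
  \<open>\<langle>DH'(\<kappa>), \<kappa>\<rangle> = \<langle>\<xi>, DK[u\<^sup>k](\<kappa>)\<xi>\<rangle> - \<langle>\<xi>, DA[u\<^sup>k](\<kappa>)\<rangle>\<close>. Hence
  \<open>G''(0) = 2 \<langle>\<xi>, DA[u\<^sup>k](\<kappa>)\<rangle> - \<langle>\<xi>, DK[u\<^sup>k](\<kappa>)\<xi>\<rangle>\<close>, and \<open>\<kappa> = - A[u\<^sup>k] = - K[u\<^sup>k]\<xi>\<close> identifies
  the right-hand side as \<open>- 2 M(u\<^sup>k, \<xi>)\<close>.

  Domains need not be open, so Frechet derivatives within \<open>D\<close> need not be unique. All identities
  between derivatives are therefore obtained by differentiating along curves on an interval, where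
  derivatives are unique.
\<close>

section \<open>The duality pairing\<close>

lemma bounded_bilinear_pairing:
  assumes E: "function_space \<Omega> rE" and Z: "function_space \<Omega> rZ" and dual: "in_duality \<Omega> rE rZ"
  shows "bounded_bilinear (pairing \<Omega> rE rZ)"
proof -
  have int: "integrable (lebesgue_on \<Omega>) (\<lambda>x. rE \<xi> x * rZ w x)" for \<xi> w
    using dual by (simp add: in_duality_def)
  have meas [measurable]: "rE \<xi> \<in> borel_measurable (lebesgue_on \<Omega>)"
      "rZ w \<in> borel_measurable (lebesgue_on \<Omega>)" for \<xi> w
    using E Z by (simp_all add: function_space_def)
  show ?thesis
  proof
    fix \<xi> \<eta> w
    have "AE x in lebesgue_on \<Omega>. rE (\<xi> + \<eta>) x = rE \<xi> x + rE \<eta> x"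
      using E by (simp add: function_space_def)
    then have "pairing \<Omega> rE rZ (\<xi> + \<eta>) w
        = (\<integral>x. rE \<xi> x * rZ w x + rE \<eta> x * rZ w x \<partial>lebesgue_on \<Omega>)"
      unfolding pairing_def by (intro integral_cong_AE) (auto simp: algebra_simps)
    then show "pairing \<Omega> rE rZ (\<xi> + \<eta>) w = pairing \<Omega> rE rZ \<xi> w + pairing \<Omega> rE rZ \<eta> w"
      by (simp add: pairing_def int)
  next
    fix \<xi> w z
    have "AE x in lebesgue_on \<Omega>. rZ (w + z) x = rZ w x + rZ z x"
      using Z by (simp add: function_space_def)
    then have "pairing \<Omega> rE rZ \<xi> (w + z)
        = (\<integral>x. rE \<xi> x * rZ w x + rE \<xi> x * rZ z x \<partial>lebesgue_on \<Omega>)"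
      unfolding pairing_def by (intro integral_cong_AE) (auto simp: algebra_simps)
    then show "pairing \<Omega> rE rZ \<xi> (w + z) = pairing \<Omega> rE rZ \<xi> w + pairing \<Omega> rE rZ \<xi> z"
      by (simp add: pairing_def int)
  next
    fix c \<xi> w
    have "AE x in lebesgue_on \<Omega>. rE (c *\<^sub>R \<xi>) x = c * rE \<xi> x"
      using E by (simp add: function_space_def)
    then have "pairing \<Omega> rE rZ (c *\<^sub>R \<xi>) w = (\<integral>x. c * (rE \<xi> x * rZ w x) \<partial>lebesgue_on \<Omega>)"
      unfolding pairing_def by (intro integral_cong_AE) auto
    then show "pairing \<Omega> rE rZ (c *\<^sub>R \<xi>) w = c *\<^sub>R pairing \<Omega> rE rZ \<xi> w"
      by (simp add: pairing_def)
  next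
    fix c \<xi> w
    have "AE x in lebesgue_on \<Omega>. rZ (c *\<^sub>R w) x = c * rZ w x"
      using Z by (simp add: function_space_def)
    then have "pairing \<Omega> rE rZ \<xi> (c *\<^sub>R w) = (\<integral>x. c * (rE \<xi> x * rZ w x) \<partial>lebesgue_on \<Omega>)"
      unfolding pairing_def by (intro integral_cong_AE) auto
    then show "pairing \<Omega> rE rZ \<xi> (c *\<^sub>R w) = c *\<^sub>R pairing \<Omega> rE rZ \<xi> w"
      by (simp add: pairing_def)
  next
    obtain C where "\<bar>pairing \<Omega> rE rZ \<xi> w\<bar> \<le> C * norm \<xi> * norm w" for \<xi> w
      using dual by (auto simp: in_duality_def)
    then show "\<exists>C. \<forall>\<xi> w. norm (pairing \<Omega> rE rZ \<xi> w) \<le> norm \<xi> * norm w * C"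
      by (metis mult.assoc mult.commute real_norm_def)
  qed
qed

section \<open>Differentiation along curves\<close>

lemma has_vector_derivative_along:
  assumes "(c has_vector_derivative w) (at t within S)" "c ` S \<subseteq> D"
    and "(f has_derivative f') (at (c t) within D)"
  shows "((\<lambda>x. f (c x)) has_vector_derivative f' w) (at t within S)"
  using vector_derivative_diff_chain_within[OF assms(1) has_derivative_subset[OF assms(3,2)]]
  by (simp add: o_def)

lemma half_open_interval_not_isolated:
  fixes t :: real
  assumes "t \<in> {l..<r}"
  shows "at t within {l..<r} \<noteq> bot"
proof -
  have "at t within {t<..<r} \<noteq> bot"
    using assms by (simp add: at_within_eq_bot_iff)
  moreover have "at t within {t<..<r} \<le> at t within {l..<r}"
    using assms by (intro at_le) auto
  ultimately show ?thesis by (metis bot.extremum_uniqueI)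
qed

text \<open>
  The product rule for \<open>A[u] = K[u] DH[u]\<close>, tested with \<open>\<xi>\<close> and taken along a curve. Symmetry
  replaces \<open>\<langle>\<xi>, K[u] DH[u]\<rangle>\<close> by \<open>\<langle>DH[u], K[u] \<xi>\<rangle>\<close>, where \<open>K\<close> acts on a fixed argument;
  differentiability of \<open>K[u]\<xi>\<close> in \<open>u\<close> for each single \<open>\<xi>\<close> then suffices.
\<close>

lemma symmetric_product_rule:
  fixes pr :: "'e::real_normed_vector \<Rightarrow> 'z::real_normed_vector \<Rightarrow> real"
    and A :: "'x::real_normed_vector \<Rightarrow> 'z" and c :: "real \<Rightarrow> 'x"
  assumes pr: "bounded_bilinear pr"
    and nontrivial: "at t within S \<noteq> bot" and t: "t \<in> S"
    and c: "(c has_vector_derivative w) (at t within S)" "c ` S \<subseteq> D"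
    and A: "(A has_derivative A') (at (c t) within D)"
    and B: "(B has_derivative B') (at (c t) within D)"
    and K: "((\<lambda>u. K u \<xi>) has_derivative K') (at (c t) within D)"
    and sym: "\<And>u \<eta>. u \<in> D \<Longrightarrow> pr \<xi> (K u \<eta>) = pr \<eta> (K u \<xi>)"
    and product: "\<And>u. u \<in> D \<Longrightarrow> A u = K u (B u)"
  shows "pr \<xi> (A' w) = pr (B (c t)) (K' w) + pr (B' w) (K (c t) \<xi>)"
proof -
  interpret bounded_bilinear pr by (rule pr)
  have "((\<lambda>x. pr \<xi> (A (c x))) has_vector_derivative pr \<xi> (A' w)) (at t within S)"
    by (rule bounded_linear.has_vector_derivative[OF bounded_linear_right])
      (rule has_vector_derivative_along[OF c A])
  moreover have "((\<lambda>x. pr (B (c x)) (K (c x) \<xi>)) has_vector_derivative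
      pr (B (c t)) (K' w) + pr (B' w) (K (c t) \<xi>)) (at t within S)"
    by (rule has_vector_derivative)
      (rule has_vector_derivative_along[OF c B] has_vector_derivative_along[OF c K])+
  then have "((\<lambda>x. pr \<xi> (A (c x))) has_vector_derivative
      pr (B (c t)) (K' w) + pr (B' w) (K (c t) \<xi>)) (at t within S)"
    by (rule has_vector_derivative_transform[OF t, rotated])
      (use c(2) in \<open>auto simp: product sym\<close>)
  ultimately show ?thesis
    using vector_derivative_unique_within[OF nontrivial] by blast
qed

section \<open>Velocity and acceleration of the backward solution\<close>

lemma weighted_stages_has_vector_derivative:
  fixes k :: "nat \<Rightarrow> real \<Rightarrow> 'x::real_normed_vector"
  assumes "\<And>i. i \<in> I \<Longrightarrow> (k i has_vector_derivative k' i) (at t within S)"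
  shows "((\<lambda>x. x *\<^sub>R (\<Sum>i\<in>I. \<beta> i *\<^sub>R k i x)) has_vector_derivative
           (\<Sum>i\<in>I. \<beta> i *\<^sub>R k i t) + t *\<^sub>R (\<Sum>i\<in>I. \<beta> i *\<^sub>R k' i)) (at t within S)"
proof -
  have "((\<lambda>x. \<Sum>i\<in>I. \<beta> i *\<^sub>R k i x) has_vector_derivative (\<Sum>i\<in>I. \<beta> i *\<^sub>R k' i)) (at t within S)"
    by (intro has_vector_derivative_sum
        bounded_linear.has_vector_derivative[OF bounded_linear_scaleR_right] assms)
  from has_vector_derivative_scaleR[OF DERIV_ident this] show ?thesis
    by (simp add: add.commute)
qed

text \<open>
  The velocity of the backward solution \<open>v(\<tau>) = u\<^sup>k - \<tau> \<Sum> b\<^sub>i K\<^sub>i(\<tau>)\<close>, in terms of the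
  stages and their derivatives \<open>k'\<close>. Its derivative at \<open>0\<close> is \<open>- 2 \<Sum> b\<^sub>i K\<^sub>i'(0)\<close>; one copy comes
  from each summand.
\<close>

definition backward_velocity ::
  "nat \<Rightarrow> (nat \<Rightarrow> real) \<Rightarrow> (nat \<Rightarrow> real \<Rightarrow> 'x::real_normed_vector) \<Rightarrow> (nat \<Rightarrow> real \<Rightarrow> 'x) \<Rightarrow> real \<Rightarrow> 'x"
  where
  "backward_velocity s b k k' \<tau> =
     - ((\<Sum>i=1..s. b i *\<^sub>R k i \<tau>) + \<tau> *\<^sub>R (\<Sum>i=1..s. b i *\<^sub>R k' i \<tau>))"

lemma has_vector_derivative_backward_solution:
  assumes k: "\<And>i. i \<in> {1..s} \<Longrightarrow> (k i has_vector_derivative k' i \<tau>) (at \<tau> within S)"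
    and step: "\<And>\<sigma>. \<sigma> \<in> S \<Longrightarrow> rk_step s a b emb D A \<sigma> (v \<sigma>) (\<lambda>i. k i \<sigma>) uk"
    and \<tau>: "\<tau> \<in> S"
  shows "(v has_vector_derivative backward_velocity s b k k' \<tau>) (at \<tau> within S)"
proof -
  have "((\<lambda>x. uk - x *\<^sub>R (\<Sum>i=1..s. b i *\<^sub>R k i x)) has_vector_derivative
      backward_velocity s b k k' \<tau>) (at \<tau> within S)"
    unfolding backward_velocity_def
    using has_vector_derivative_diff[OF has_vector_derivative_const
        weighted_stages_has_vector_derivative[where k = k and I = "{1..s}" and \<beta> = b, OF k]] by simp
  then show ?thesis
    by (rule has_vector_derivative_transform[OF \<tau>, rotated])
      (use step in \<open>auto simp: rk_step_def\<close>)
qed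

lemma has_vector_derivative_backward_velocity_0:
  assumes k: "\<And>i. i \<in> {1..s} \<Longrightarrow> (k i has_vector_derivative k' i 0) (at 0 within S)"
    and k': "\<And>i. i \<in> {1..s} \<Longrightarrow> (k' i has_vector_derivative k'' i) (at 0 within S)"
  shows "(backward_velocity s b k k' has_vector_derivative
           - 2 *\<^sub>R (\<Sum>i=1..s. b i *\<^sub>R k' i 0)) (at 0 within S)"
proof -
  have "((\<lambda>x. \<Sum>i=1..s. b i *\<^sub>R k i x) has_vector_derivative (\<Sum>i=1..s. b i *\<^sub>R k' i 0)) (at 0 within S)"
    by (intro has_vector_derivative_sum
        bounded_linear.has_vector_derivative[OF bounded_linear_scaleR_right] k)
  from has_vector_derivative_minus[OF has_vector_derivative_add[OF this
        weighted_stages_has_vector_derivative[where k = k' and I = "{1..s}" and \<beta> = b, OF k']]]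
  show ?thesis
    by (simp add: backward_velocity_def[abs_def] scaleR_2)
qed

text \<open>
  At \<open>\<tau> = 0\<close> the argument of \<open>A\<close> in the \<open>i\<close>-th stage moves with velocity
  \<open>v'(0) + c\<^sub>i \<kappa> = - (1 - c\<^sub>i) \<kappa>\<close>, where \<open>\<kappa>\<close> is the common value of all stages there.
\<close>

lemma stage_derivative_0:
  assumes emb: "bounded_linear emb"
    and A: "\<And>u. u \<in> D \<Longrightarrow> (A has_derivative DA u) (at u within D)"
    and nontrivial: "at 0 within S \<noteq> bot" and S: "0 \<in> S"
    and k: "\<And>i. i \<in> {1..s} \<Longrightarrow> (k i has_vector_derivative k' i 0) (at 0 within S)"
    and v: "(v has_vector_derivative - \<kappa>) (at 0 within S)"
    and step: "\<And>\<tau>. \<tau> \<in> S \<Longrightarrow> rk_step s a b emb D A \<tau> (v \<tau>) (\<lambda>i. k i \<tau>) uk"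
    and common: "\<And>i. i \<in> {1..s} \<Longrightarrow> k i 0 = \<kappa>"
    and i: "i \<in> {1..s}"
  shows "emb (k' i 0) = (1 - (\<Sum>j=1..s. a i j)) *\<^sub>R DA uk \<kappa>"
proof -
  define y where "y = (\<lambda>\<tau>. v \<tau> + \<tau> *\<^sub>R (\<Sum>j=1..s. a i j *\<^sub>R k j \<tau>))"
  define \<gamma> where "\<gamma> = (\<Sum>j=1..s. a i j)"
  have y: "y \<tau> \<in> D" "emb (k i \<tau>) = - A (y \<tau>)" if "\<tau> \<in> S" for \<tau>
    using step[OF that] i by (auto simp: rk_step_def y_def)
  have v0: "v 0 = uk" using step[OF S] by (simp add: rk_step_def)
  then have y0: "y 0 = uk" by (simp add: y_def)
  have uk: "uk \<in> D" using y(1)[OF S] y0 by simp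
  interpret DA: bounded_linear "DA uk" using A[OF uk] by (rule has_derivative_bounded_linear)
  have "(\<Sum>j=1..s. a i j *\<^sub>R k j 0) = \<gamma> *\<^sub>R \<kappa>"
    unfolding \<gamma>_def scaleR_left.sum by (intro sum.cong) (simp_all add: common)
  then have dy: "(y has_vector_derivative (\<gamma> - 1) *\<^sub>R \<kappa>) (at 0 within S)"
    unfolding y_def
    using has_vector_derivative_add[OF v
        weighted_stages_has_vector_derivative[where k = k and I = "{1..s}" and \<beta> = "a i", OF k]]
    by (simp add: scaleR_left_diff_distrib)
  have "((\<lambda>\<tau>. A (y \<tau>)) has_vector_derivative DA uk ((\<gamma> - 1) *\<^sub>R \<kappa>)) (at 0 within S)"
    by (rule has_vector_derivative_along[OF dy, where D = D]) (use y y0 A[OF uk] in auto)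
  from has_vector_derivative_minus[OF this]
  have "((\<lambda>\<tau>. - A (y \<tau>)) has_vector_derivative (1 - \<gamma>) *\<^sub>R DA uk \<kappa>) (at 0 within S)"
    by (simp add: DA.scaleR DA.diff scaleR_left_diff_distrib)
  then have "((\<lambda>\<tau>. emb (k i \<tau>)) has_vector_derivative (1 - \<gamma>) *\<^sub>R DA uk \<kappa>) (at 0 within S)"
    by (rule has_vector_derivative_transform[OF S, rotated]) (simp add: y)
  moreover have "((\<lambda>\<tau>. emb (k i \<tau>)) has_vector_derivative emb (k' i 0)) (at 0 within S)"
    by (rule bounded_linear.has_vector_derivative[OF emb k[OF i]])
  ultimately show ?thesis
    unfolding \<gamma>_def using vector_derivative_unique_within[OF nontrivial] by blast
qed

text \<open>
  The two conditions of order two combine to \<open>2 \<Sum> b\<^sub>i (1 - c\<^sub>i) = 2 (1 - 1/2) = 1\<close>.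
\<close>

lemma backward_acceleration:
  assumes emb: "bounded_linear emb" and order: "rk_order s a b p" "p \<ge> 2"
    and stages: "\<And>i. i \<in> {1..s} \<Longrightarrow> emb (d i) = (1 - (\<Sum>j=1..s. a i j)) *\<^sub>R z"
  shows "emb (- 2 *\<^sub>R (\<Sum>i=1..s. b i *\<^sub>R d i)) = - z"
proof -
  interpret bounded_linear emb by (rule emb)
  have "(\<Sum>i=1..s. b i * (1 - (\<Sum>j=1..s. a i j))) = 1 / 2"
    using rk_order_consistent[OF order(1)] rk_order_two[OF order] order(2)
    by (simp add: right_diff_distrib sum_subtractf)
  moreover have "emb (\<Sum>i=1..s. b i *\<^sub>R d i) = (\<Sum>i=1..s. b i * (1 - (\<Sum>j=1..s. a i j))) *\<^sub>R z"
    unfolding sum scaleR scaleR_left.sum by (intro sum.cong) (simp_all add: stages)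
  ultimately have "emb (\<Sum>i=1..s. b i *\<^sub>R d i) = (1 / 2) *\<^sub>R z" by (simp only:)
  then show ?thesis by (simp add: scaleR neg)
qed

section \<open>The second derivative of the entropy difference\<close>

theorem lemma6:
  fixes \<Omega> :: "'a::euclidean_space set"
    and rX :: "'x::banach \<Rightarrow> 'a \<Rightarrow> real"
    and rZ :: "'z::real_normed_vector \<Rightarrow> 'a \<Rightarrow> real"
    and rE :: "'e::real_normed_vector \<Rightarrow> 'a \<Rightarrow> real"
    and emb :: "'x \<Rightarrow> 'z"
    and D :: "'x set"
    and A :: "'x \<Rightarrow> 'z" and DA :: "'x \<Rightarrow> 'x \<Rightarrow> 'z"
    and K :: "'x \<Rightarrow> 'e \<Rightarrow> 'z" and DK :: "'x \<Rightarrow> 'x \<Rightarrow> 'e \<Rightarrow> 'z"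
    and h :: "real \<Rightarrow> real" and DH :: "'x \<Rightarrow> 'e"
    and s p :: nat and a :: "nat \<Rightarrow> nat \<Rightarrow> real" and b :: "nat \<Rightarrow> real"
    and uk :: 'x and T :: real
    and v :: "real \<Rightarrow> 'x" and Ki :: "nat \<Rightarrow> real \<Rightarrow> 'x"
    and G :: "real \<Rightarrow> real"
  assumes "\<Omega> \<in> sets lebesgue"
    and "function_space \<Omega> rX" and "function_space \<Omega> rZ" and "function_space \<Omega> rE"
    and "continuous_embedding \<Omega> rX rZ emb"
    and "in_duality \<Omega> rE rZ"
    and "\<And>u. u \<in> D \<Longrightarrow> (A has_derivative DA u) (at u within D)"
    and "\<And>u. u \<in> D \<Longrightarrow> integrable (lebesgue_on \<Omega>) (\<lambda>x. h (rX u x))"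
    and "\<And>u. u \<in> D \<Longrightarrow> AE x in lebesgue_on \<Omega>. h field_differentiable at (rX u x)"
    and "\<And>u. u \<in> D \<Longrightarrow> AE x in lebesgue_on \<Omega>. rE (DH u) x = deriv h (rX u x)"
    and "\<And>u. u \<in> D \<Longrightarrow>
           (entropy \<Omega> rX h has_derivative (\<lambda>w. pairing \<Omega> rE rZ (DH u) (emb w))) (at u within D)"
    and "DH differentiable_on D"
    and "\<And>u. u \<in> D \<Longrightarrow> linear (K u)"
    and "\<And>u \<xi> \<eta>. u \<in> D \<Longrightarrow> pairing \<Omega> rE rZ \<xi> (K u \<eta>) = pairing \<Omega> rE rZ \<eta> (K u \<xi>)"
    and "\<And>u \<xi>. u \<in> D \<Longrightarrow> ((\<lambda>u. K u \<xi>) has_derivative (\<lambda>w. DK u w \<xi>)) (at u within D)"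
    and "\<And>u. u \<in> D \<Longrightarrow> A u = K u (DH u)"
    and "s \<ge> 1" and "p \<ge> 2" and "rk_order s a b p"
    and "T > 0"
    and "C2_on v {0..<T}" and "\<And>i. i \<in> {1..s} \<Longrightarrow> C2_on (Ki i) {0..<T}"
    and "\<And>\<tau>. \<tau> \<in> {0..<T} \<Longrightarrow> v \<tau> \<in> D"
    and "\<And>\<tau>. \<tau> \<in> {0..<T} \<Longrightarrow> rk_step s a b emb D A \<tau> (v \<tau>) (\<lambda>i. Ki i \<tau>) uk"
    and "\<And>\<tau>. G \<tau> = entropy \<Omega> rX h uk - entropy \<Omega> rX h (v \<tau>)"
  shows "\<exists>G'. (\<forall>\<tau>\<in>{0..<T}. (G has_real_derivative G' \<tau>) (at \<tau> within {0..<T})) \<and>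
           (G' has_real_derivative - 2 * M_form (pairing \<Omega> rE rZ) emb A DA K DK uk (DH uk))
             (at 0 within {0..<T})"
proof -
  note duality = \<open>in_duality \<Omega> rE rZ\<close>
  note A_deriv = assms(7) and H_deriv = assms(11)
  note K_sym = assms(14) and K_deriv = assms(15) and A_eq = assms(16)
  note order = \<open>rk_order s a b p\<close> \<open>p \<ge> 2\<close>
  note k_C2 = assms(22) and v_D = assms(23) and step = assms(24) and G_eq = assms(25)
  let ?S = "{0..<T}"
  let ?pr = "pairing \<Omega> rE rZ"
  have S: "0 \<in> ?S" using \<open>T > 0\<close> by simp
  have nontrivial: "at 0 within ?S \<noteq> bot" using S by (rule half_open_interval_not_isolated)
  have pr: "bounded_bilinear ?pr"
    using assms(3,4) duality by (intro bounded_bilinear_pairing)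
  interpret pr: bounded_bilinear ?pr by (rule pr)
  have emb: "bounded_linear emb"
    using assms(5) by (simp add: continuous_embedding_def)
  interpret emb: bounded_linear emb by (rule emb)
  have inj: "inj emb"
    using assms(2,3,5) by (intro continuous_embedding_inj)
  have v0: "v 0 = uk" using step[OF S] by (simp add: rk_step_def)
  have uk: "uk \<in> D" using v_D[OF S] v0 by simp
  have v_image: "v ` ?S \<subseteq> D" using v_D by auto

  have "\<forall>i\<in>{1..s}. \<exists>k' k''. \<forall>t\<in>?S. (Ki i has_vector_derivative k' t) (at t within ?S) \<and>
      (k' has_vector_derivative k'' t) (at t within ?S)"
    using k_C2 unfolding C2_on_def by meson
  from bchoice[OF this] obtain k' where
    "\<forall>i\<in>{1..s}. \<exists>k''. \<forall>t\<in>?S. (Ki i has_vector_derivative k' i t) (at t within ?S) \<and>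
      (k' i has_vector_derivative k'' t) (at t within ?S)" ..
  from bchoice[OF this] obtain k'' where
    k: "\<And>i t. i \<in> {1..s} \<Longrightarrow> t \<in> ?S \<Longrightarrow> (Ki i has_vector_derivative k' i t) (at t within ?S)" and
    k': "\<And>i t. i \<in> {1..s} \<Longrightarrow> t \<in> ?S \<Longrightarrow> (k' i has_vector_derivative k'' i t) (at t within ?S)"
    by blast
  define V where "V = backward_velocity s b Ki k'"
  have V: "(v has_vector_derivative V t) (at t within ?S)" if "t \<in> ?S" for t
    unfolding V_def
    by (rule has_vector_derivative_backward_solution[where k = Ki and k' = k', OF k[OF _ that] step that])

  define \<kappa> where "\<kappa> = Ki 1 0"
  have emb_stage: "emb (Ki i 0) = - A uk" if "i \<in> {1..s}" for i
    using step[OF S] that v0 by (simp add: rk_step_def)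
  have emb_\<kappa>: "emb \<kappa> = - A uk"
    using emb_stage[of 1] \<open>s \<ge> 1\<close> by (simp add: \<kappa>_def)
  have common: "Ki i 0 = \<kappa>" if "i \<in> {1..s}" for i
    using emb_stage[OF that] emb_\<kappa> inj by (metis injD)
  have V0: "V 0 = - \<kappa>"
    using rk_order_consistent[OF order(1)] order(2) common
    by (simp add: V_def backward_velocity_def flip: scaleR_left.sum)
  have inv_A: "inv emb (A uk) = - \<kappa>"
    using inv_f_f[OF inj, of "- \<kappa>"] by (simp add: emb.neg emb_\<kappa>)

  define W where "W = - 2 *\<^sub>R (\<Sum>i=1..s. b i *\<^sub>R k' i 0)"
  have W: "(V has_vector_derivative W) (at 0 within ?S)"
    unfolding V_def W_def
    by (rule has_vector_derivative_backward_velocity_0[where k = Ki and k' = k',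
          OF k[OF _ S] k'[OF _ S]])
  have emb_W: "emb W = - DA uk \<kappa>"
    unfolding W_def
  proof (rule backward_acceleration[OF emb order])
    show "emb (k' i 0) = (1 - (\<Sum>j=1..s. a i j)) *\<^sub>R DA uk \<kappa>" if "i \<in> {1..s}" for i
      using stage_derivative_0[where k = Ki and k' = k',
          OF emb A_deriv nontrivial S k[OF _ S] _ step common that] V[OF S] V0
      by simp
  qed

  obtain DH' where DH': "(DH has_derivative DH') (at uk within D)"
    using \<open>DH differentiable_on D\<close> uk by (auto simp: differentiable_on_def differentiable_def)
  interpret DA: bounded_linear "DA uk"
    using A_deriv[OF uk] by (rule has_derivative_bounded_linear)
  interpret DH': bounded_linear DH'
    using DH' by (rule has_derivative_bounded_linear)

  \<comment> \<open>Since \<open>A[u\<^sup>k]\<close> is \<open>emb (- \<kappa>)\<close>, and \<open>- \<kappa> = v'(0)\<close>, the last summand is exactly the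
      second-derivative term \<open>\<langle>DH'(v'(0)), v'(0)\<rangle>\<close> that has to be eliminated.\<close>
  have product: "?pr (DH uk) (DA uk (- \<kappa>)) =
      ?pr (DH uk) (DK uk (- \<kappa>) (DH uk)) + ?pr (DH' (- \<kappa>)) (A uk)"
    by (rule symmetric_product_rule[OF pr nontrivial S V[OF S] v_image, where A = A and B = DH
          and K = K and \<xi> = "DH uk" and A' = "DA uk" and B' = DH'
          and K' = "\<lambda>w. DK uk w (DH uk)", unfolded v0 V0 A_eq[OF uk, symmetric],
          OF A_deriv[OF uk] DH' K_deriv[OF uk] K_sym A_eq])

  define G' where "G' = (\<lambda>t. - ?pr (DH (v t)) (emb (V t)))"
  have "(G has_real_derivative G' t) (at t within ?S)" if t: "t \<in> ?S" for t
  proof -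
    have "((\<lambda>\<tau>. entropy \<Omega> rX h uk - entropy \<Omega> rX h (v \<tau>)) has_vector_derivative
        0 - ?pr (DH (v t)) (emb (V t))) (at t within ?S)"
      by (intro has_vector_derivative_diff has_vector_derivative_const
          has_vector_derivative_along[OF V[OF t] v_image H_deriv[OF v_D[OF t]]])
    then show ?thesis
      by (simp add: G'_def G_eq[abs_def] has_real_derivative_iff_has_vector_derivative)
  qed
  moreover have "(G' has_real_derivative
      - 2 * M_form ?pr emb A DA K DK uk (DH uk)) (at 0 within ?S)"
  proof -
    have "((\<lambda>t. DH (v t)) has_vector_derivative DH' (V 0)) (at 0 within ?S)"
      by (rule has_vector_derivative_along[OF V[OF S] v_image]) (simp add: v0 DH')
    from has_vector_derivative_minus[OF pr.has_vector_derivative[OF this emb.has_vector_derivative[OF W]]]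
    have "(G' has_vector_derivative
        - (?pr (DH uk) (emb W) + ?pr (DH' (- \<kappa>)) (emb (- \<kappa>)))) (at 0 within ?S)"
      by (simp add: G'_def v0 V0)
    moreover have "- (?pr (DH uk) (emb W) + ?pr (DH' (- \<kappa>)) (emb (- \<kappa>))) =
        - 2 * M_form ?pr emb A DA K DK uk (DH uk)"
      using product
      by (simp add: M_form_def inv_A emb_W emb_\<kappa> emb.neg DA.neg DH'.neg pr.minus_left
          pr.minus_right flip: A_eq[OF uk])
    ultimately show ?thesis
      by (simp add: has_real_derivative_iff_has_vector_derivative)
  qed
  ultimately show ?thesis by blast
qed

end
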